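(* In the setting described in the context, let $p\in[1,2]$ and assume that, for every $k\in[1,n]$, $$\mathbb E\big[(H_{k,\varepsilon_k}(X_{k-1},\ldots,X_1,\varepsilon_k))^p\big]\le A_k(p)$$ for some constants $A_k(p)$. Then $$\|S_n\|_p\le\big(A(n,p)\big)^{1/p},$$ where $$A(n,p)=A_1(p)\big(a_{n-1}(n-1)\big)^p+2^{2-p}\sum_{k=2}^n\big(a_{n-k}(n-k)\big)^pA_k(p).$$ It follows that, for every $x>0$, $$\mathbb P(|S_n|\ge nx)\le\frac{A(n,p)}{(nx)^p}.$$
   Context: Let $(\mathcal X,d)$ and $(\mathcal Y,\delta)$ be complete separable metric spaces. Let $(\varepsilon_i)_{i\ge1}$ be independent (not necessarily identically distributed) $\mathcal Y$-valued random variables, with $P_{\varepsilon_k}$ the law of $\varepsilon_k$. Let $(X_i)_{i\le0}$ be a deterministic sequence in $\mathcal X$. For each $m\ge1$ let $F_m:\mathcal X^{\mathbb N}\times\mathcal Y\to\mathcal X$ be measurable, and define recursively $X_m=F_m((X_{m-i})_{i\ge1};\varepsilon_m)$ for $m\ge1$. Assume there are nonnegative numbers $a_i$, $i\ge1$, with $\sum_{i\ge1}a_i<1$, such that for all $m\ge1$ and all sequences $(x_{m-i})_{i\ge1},(x'_{m-i})_{i\ge1}$ in $\mathcal X$, $$\mathbb E\big[d\big(F_m((x_{m-i})_{i\ge1};\varepsilon_m),F_m((x'_{m-i})_{i\ge1};\varepsilon_m)\big)\big]\le\sum_{i=1}^\infty a_i\,d(x_{m-i},x'_{m-i}).$$ Fix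 $n\ge1$ and let $f:\mathcal X^n\to\mathbb R$ satisfy $|f(x_1,\ldots,x_n)-f(x'_1,\ldots,x'_n)|\le\sum_{i=1}^n d(x_i,x'_i)$. Put $S_n=f(X_1,\ldots,X_n)-\mathbb E[f(X_1,\ldots,X_n)]$, and $\|Z\|_p=(\mathbb E|Z|^p)^{1/p}$. The numbers $a_k(k)$, $k\ge0$, are defined recursively by $a_0(0)=1$ and $a_k(k)=1+a_k+\sum_{l=1}^{k-1}a_l(l)\,a_{k-l}$ for $k\ge1$ (so $a_1(1)=1+a_1$). For $k\ge1$, $$H_{k,\varepsilon_k}(X_{k-1},\ldots,X_1,\varepsilon_k)=\int d\big(F_k(X_{k-1},\ldots,X_1,X_0,X_{-1},\ldots;\varepsilon_k),F_k(X_{k-1},\ldots,X_1,X_0,X_{-1},\ldots;y)\big)P_{\varepsilon_k}(dy),$$ which for $k=1$ is $H_{1,\varepsilon_1}(\varepsilon_1)=\int d(F_1(X_0,X_{-1},\ldots;\varepsilon_1),F_1(X_0,X_{-1},\ldots;y))P_{\varepsilon_1}(dy)$. *)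

theory Defs
  imports "HOL-Probability.Probability"
begin

text \<open>
  A sequence $(x_{m-i})_{i \ge 1}$ is encoded as a function \<open>s :: nat \<Rightarrow> 'x\<close> with
  $s\,j = x_{m-1-j}$, so that position \<open>j\<close> carries the index $i = j + 1$.
\<close>

definition past :: "(int \<Rightarrow> 'w \<Rightarrow> 'x) \<Rightarrow> nat \<Rightarrow> 'w \<Rightarrow> (nat \<Rightarrow> 'x)" where
  "past X m \<omega> = (\<lambda>j. X (int m - 1 - int j) \<omega>)"

text \<open>
  The coefficients $a_k(k)$. The value \<open>a 0\<close> is never used.
\<close>

fun diag_coeff :: "(nat \<Rightarrow> real) \<Rightarrow> nat \<Rightarrow> real" where
  "diag_coeff a 0 = 1"
| "diag_coeff a (Suc k) = 1 + a (Suc k) + (\<Sum>l = 1..k. diag_coeff a l * a (Suc k - l))"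

text \<open>
  Real powers of extended nonnegative reals, meant for exponents \<open>r > 0\<close>.
\<close>

definition epowr :: "ennreal \<Rightarrow> real \<Rightarrow> ennreal" where
  "epowr z r = (if z = \<top> then \<top> else ennreal (enn2real z powr r))"

definition Lp_norm :: "'w measure \<Rightarrow> real \<Rightarrow> ('w \<Rightarrow> real) \<Rightarrow> ennreal" where
  "Lp_norm M p Z = epowr (\<integral>\<^sup>+ \<omega>. ennreal (\<bar>Z \<omega>\<bar> powr p) \<partial>M) (1 / p)"

text \<open>
  \<open>H_fun G P s e\<close> is $\int d(G(s;e), G(s;y))\,P(dy)$, with values in $[0,\infty]$. Taking
  $G = F_k$, $P = P_{\varepsilon_k}$, $s = (X_{k-1}, \ldots, X_1, X_0, X_{-1}, \ldots)$ and
  $e = \varepsilon_k$ gives the random variable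
  $H_{k,\varepsilon_k}(X_{k-1}, \ldots, X_1, \varepsilon_k)$.
\<close>

definition H_fun ::
  "((nat \<Rightarrow> 'x::metric_space) \<Rightarrow> 'y \<Rightarrow> 'x) \<Rightarrow> 'y measure \<Rightarrow> (nat \<Rightarrow> 'x) \<Rightarrow> 'y \<Rightarrow> ennreal" where
  "H_fun G P s e = (\<integral>\<^sup>+ y. ennreal (dist (G s e) (G s y)) \<partial>P)"

text \<open>
  $\mathcal{X}^n$ is rendered as \<open>{1..n} \<rightarrow>\<^sub>E UNIV\<close>, hence the restricted abstraction for
  the argument $(X_1, \ldots, X_n)$ of \<open>f\<close>.
\<close>

definition f_of_X :: "((nat \<Rightarrow> 'x) \<Rightarrow> real) \<Rightarrow> (int \<Rightarrow> 'w \<Rightarrow> 'x) \<Rightarrow> nat \<Rightarrow> 'w \<Rightarrow> real" where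
  "f_of_X f X n \<omega> = f (\<lambda>i\<in>{1..n}. X (int i) \<omega>)"

definition S_dev ::
  "'w measure \<Rightarrow> ((nat \<Rightarrow> 'x) \<Rightarrow> real) \<Rightarrow> (int \<Rightarrow> 'w \<Rightarrow> 'x) \<Rightarrow> nat \<Rightarrow> 'w \<Rightarrow> real" where
  "S_dev M f X n \<omega> = f_of_X f X n \<omega> - (\<integral>\<omega>'. f_of_X f X n \<omega>' \<partial>M)"

definition A_bound :: "(nat \<Rightarrow> real) \<Rightarrow> (nat \<Rightarrow> real) \<Rightarrow> nat \<Rightarrow> real \<Rightarrow> real" where
  "A_bound a A n p =
     A 1 * (diag_coeff a (n - 1)) powr p
     + 2 powr (2 - p) * (\<Sum>k = 2..n. (diag_coeff a (n - k)) powr p * A k)"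

end

theory Submission
  imports Defs
begin

text \<open>
  The pasts $Z_k = (X_k, X_{k-1}, \ldots)$ form a Markov chain driven by $\varepsilon_{k+1}$, and
  integrating out the last innovations one at a time gives functions $G_m$ with
  $G_m(Z_{n-m}) = E[f(X_1,\ldots,X_n) \mid \varepsilon_1,\ldots,\varepsilon_{n-m}]$.
  By the contraction property, $G_m$ is Lipschitz in its most recent argument with constant
  $a_m(m)$, so the martingale increment at time $k$ is at most $a_{n-k}(n-k)\,H_k$. The moment
  bound follows by integrating the von Bahr--Esseen inequality
  $|x+b|^p \le |x|^p + p\,\mathrm{sgn}(x)|x|^{p-1} b + 2^{2-p}|b|^p$ one step at a time; its linear
  term vanishes because the increments are centred. The first increment starts from $x = 0$, hence
  carries no factor $2^{2-p}$.
\<close>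

section \<open>The von Bahr--Esseen inequality\<close>

text \<open>Midpoint convexity of t^(1/q), applied at u^q and v^q. With q = p - 1 the constant
  becomes 2^(2-p), the factor in the final bound.\<close>

lemma sum_powr_le_powr_sum_half:
  fixes u v q :: real
  assumes "0 < q" "q \<le> 1" "0 \<le> u" "0 \<le> v"
  shows "u powr q + v powr q \<le> 2 powr (1 - q) * (u + v) powr q"
proof (cases "u = 0 \<or> v = 0")
  case True
  then show ?thesis
    using assms ge_one_powr_ge_zero[of 2 "1 - q"] by (auto simp: mult_le_cancel_right1)
next
  case False
  with assms have uv: "0 < u" "0 < v" by auto
  have "((1 - 1 / 2) *\<^sub>R u powr q + (1 / 2) *\<^sub>R v powr q) powr (1 / q)
        \<le> (1 - 1 / 2) * (u powr q) powr (1 / q) + (1 / 2) * (v powr q) powr (1 / q)"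
    using uv assms by (intro convex_onD[OF powr_convex]) auto
  also have "\<dots> = (u + v) / 2"
    using uv assms by (simp add: powr_powr)
  finally have "((u powr q + v powr q) / 2) powr (1 / q) \<le> (u + v) / 2"
    by (simp add: field_simps)
  then have "(((u powr q + v powr q) / 2) powr (1 / q)) powr q \<le> ((u + v) / 2) powr q"
    using assms by (intro powr_mono2) auto
  then have "(u powr q + v powr q) / 2 \<le> ((u + v) / 2) powr q"
    using uv assms by (simp add: powr_powr)
  then show ?thesis
    using uv by (simp add: powr_divide powr_diff field_simps)
qed

text \<open>After division by u + v both terms lie in [0,1], where t is at most t^q, and the two
  fractions add up to 1.\<close>

lemma powr_add_le_add_powr:
  fixes u v q :: real
  assumes "0 < q" "q \<le> 1" "0 \<le> u" "0 \<le> v"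
  shows "(u + v) powr q \<le> u powr q + v powr q"
proof (cases "u + v = 0")
  case True
  then show ?thesis by simp
next
  case False
  with assms have pos: "0 < u + v" by linarith
  have le: "t \<le> t powr q" if "0 \<le> t" "t \<le> 1" for t :: real
    using that assms powr_mono'[of q 1 t] by (cases "t = 0") auto
  have "1 = u / (u + v) + v / (u + v)"
    using pos by (simp add: add_divide_distrib[symmetric])
  also have "\<dots> \<le> (u / (u + v)) powr q + (v / (u + v)) powr q"
    using assms pos by (intro add_mono le) (auto simp: field_simps)
  also have "\<dots> = (u powr q + v powr q) / (u + v) powr q"
    using assms pos by (simp add: powr_divide add_divide_distrib)
  finally show ?thesis using pos by (simp add: field_simps)
qed

lemma has_real_derivative_abs_powr:
  fixes x p :: real
  assumes "1 < p"
  shows "((\<lambda>x. \<bar>x\<bar> powr p) has_real_derivative p * (sgn x * \<bar>x\<bar> powr (p - 1))) (at x)"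
proof (cases x "0 :: real" rule: linorder_cases)
  case greater
  have "((\<lambda>x. x powr p) has_real_derivative p * (sgn x * \<bar>x\<bar> powr (p - 1))) (at x)"
    using greater by (auto intro!: derivative_eq_intros simp: powr_diff)
  then show ?thesis
    by (rule has_field_derivative_transform_within_open[where S = "{0<..}"]) (use greater in auto)
next
  case less
  have "((\<lambda>x. (- x) powr p) has_real_derivative p * (sgn x * \<bar>x\<bar> powr (p - 1))) (at x)"
    using less by (auto intro!: derivative_eq_intros simp: powr_diff field_simps)
  then show ?thesis
    by (rule has_field_derivative_transform_within_open[where S = "{..<0}"]) (use less in auto)
next
  case equal
  \<comment> \<open>At 0 the difference quotient has absolute value |h|^(p-1), which tends to 0
    because p > 1.\<close>
  have "((\<lambda>h::real. \<bar>h\<bar> powr (p - 1)) \<longlongrightarrow> \<bar>0\<bar> powr (p - 1)) (at 0)"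
    using assms by (intro tendsto_powr' tendsto_intros) auto
  moreover have "\<bar>h\<bar> powr (p - 1) = \<bar>\<bar>h\<bar> powr p / h\<bar>" if "h \<noteq> 0" for h :: real
    using that by (simp add: powr_diff)
  ultimately have "((\<lambda>h::real. \<bar>\<bar>h\<bar> powr p / h\<bar>) \<longlongrightarrow> 0) (at 0)"
    by (auto simp: eventually_at_filter elim!: Lim_transform_eventually)
  then have "((\<lambda>h::real. \<bar>h\<bar> powr p / h) \<longlongrightarrow> 0) (at 0)"
    by (rule tendsto_rabs_zero_cancel)
  then show ?thesis using equal assms by (simp add: DERIV_def)
qed

text \<open>Hoelder continuity of the signed power, needed for the derivative of |x|^p. If x and x +
  t lie on the same side of 0, subadditivity gives constant 1. If they straddle 0, the difference is
  (-x)^q + (x+t)^q with bases summing to t, and this case costs the factor 2^(1-q).\<close>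

lemma sgn_powr_diff_le:
  fixes x t q :: real
  assumes "0 < q" "q \<le> 1" "0 \<le> t"
  shows "sgn (x + t) * \<bar>x + t\<bar> powr q - sgn x * \<bar>x\<bar> powr q \<le> 2 powr (1 - q) * t powr q"
proof -
  have one: "t powr q \<le> 2 powr (1 - q) * t powr q"
    using assms ge_one_powr_ge_zero[of 2 "1 - q"] by (simp add: mult_le_cancel_right1)
  consider "0 \<le> x" | "x + t \<le> 0" | "x < 0" "0 < x + t" by linarith
  then show ?thesis
  proof cases
    case 1
    have sgn: "sgn y * \<bar>y\<bar> powr q = y powr q" if "0 \<le> y" for y :: real
      using that by (cases "y = 0") auto
    show ?thesis
      unfolding sgn[OF 1(1)] sgn[OF add_nonneg_nonneg[OF 1(1) assms(3)]]
      using powr_add_le_add_powr[of q x t] 1 assms one by simp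
  next
    case 2
    have sgn: "sgn y * \<bar>y\<bar> powr q = - ((- y) powr q)" if "y \<le> 0" for y :: real
      using that by (cases "y = 0") auto
    have "x \<le> 0" using 2 assms by linarith
    then show ?thesis
      unfolding sgn[OF 2(1)] sgn[OF \<open>x \<le> 0\<close>]
      using powr_add_le_add_powr[of q "- x - t" t] 2 assms one by simp
  next
    case 3
    then show ?thesis
      using sum_powr_le_powr_sum_half[of q "- x" "x + t"] assms by simp
  qed
qed

text \<open>For p > 1 and b nonnegative, the right side minus the left side vanishes at b = 0 and
  has nonnegative derivative in b, by the Hoelder bound with exponent p - 1. The symmetry (x, b) ->
  (-x, -b) covers negative b. The case p = 1, where |x| has a corner at 0, is checked by
  signs.\<close>

lemma abs_add_powr_le:
  fixes x b p :: real
  assumes "1 \<le> p" "p \<le> 2"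
  shows "\<bar>x + b\<bar> powr p
    \<le> \<bar>x\<bar> powr p + p * (sgn x * \<bar>x\<bar> powr (p - 1)) * b + 2 powr (2 - p) * \<bar>b\<bar> powr p"
proof (cases "p = 1")
  case True
  then show ?thesis by (auto simp: sgn_if abs_if)
next
  case False
  then have p: "1 < p" using assms by simp
  have pos: "\<bar>x + b\<bar> powr p
    \<le> \<bar>x\<bar> powr p + p * (sgn x * \<bar>x\<bar> powr (p - 1)) * b + 2 powr (2 - p) * \<bar>b\<bar> powr p"
    if b: "0 \<le> b" for x b :: real
  proof -
    define h where "h t = \<bar>x\<bar> powr p + p * (sgn x * \<bar>x\<bar> powr (p - 1)) * t
      + 2 powr (2 - p) * \<bar>t\<bar> powr p - \<bar>x + t\<bar> powr p" for t
    have "h 0 \<le> h b"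
    proof (rule DERIV_nonneg_imp_nondecreasing[OF b])
      fix t :: real assume t: "0 \<le> t"
      have "(h has_real_derivative (p * (sgn x * \<bar>x\<bar> powr (p - 1))
          + 2 powr (2 - p) * (p * (sgn t * \<bar>t\<bar> powr (p - 1)))
          - p * (sgn (x + t) * \<bar>x + t\<bar> powr (p - 1)))) (at t)" (is "(_ has_real_derivative ?D) _")
      proof -
        have "((\<lambda>t. \<bar>x + t\<bar> powr p) has_real_derivative
            p * (sgn (x + t) * \<bar>x + t\<bar> powr (p - 1)) * (0 + 1)) (at t)"
          by (intro DERIV_chain2[OF has_real_derivative_abs_powr[OF p]] DERIV_add
              DERIV_const DERIV_ident)
        from DERIV_diff[OF DERIV_add[OF DERIV_add[OF DERIV_const DERIV_cmult[OF DERIV_ident]]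
              DERIV_cmult[OF has_real_derivative_abs_powr[OF p]]] this]
        show ?thesis unfolding h_def by simp
      qed
      moreover have "0 \<le> ?D"
      proof -
        have "?D = p * (2 powr (1 - (p - 1)) * t powr (p - 1)
          - (sgn (x + t) * \<bar>x + t\<bar> powr (p - 1) - sgn x * \<bar>x\<bar> powr (p - 1)))"
          using t by (cases "t = 0") (auto simp: algebra_simps)
        also have "\<dots> \<ge> 0"
          using sgn_powr_diff_le[of "p - 1" t x] p assms t by simp
        finally show ?thesis .
      qed
      ultimately show "\<exists>y. (h has_real_derivative y) (at t) \<and> 0 \<le> y" by blast
    qed
    then show ?thesis by (simp add: h_def)
  qed
  show ?thesis
  proof (cases "0 \<le> b")
    case True
    then show ?thesis by (rule pos)
  next
    case False
    then show ?thesis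
      using pos[of "- b" "- x"] abs_minus_cancel[of "x + b"] by (simp add: sgn_minus)
  qed
qed

lemma (in prob_space) nn_integral_abs_add_powr_le:
  fixes b :: "'a \<Rightarrow> real" and c p :: real
  assumes "1 \<le> p" "p \<le> 2" and b: "integrable M b" "expectation b = 0"
  shows "(\<integral>\<^sup>+ y. ennreal (\<bar>c + b y\<bar> powr p) \<partial>M)
    \<le> ennreal (\<bar>c\<bar> powr p) + ennreal (2 powr (2 - p)) * (\<integral>\<^sup>+ y. ennreal (\<bar>b y\<bar> powr p) \<partial>M)"
proof (cases "(\<integral>\<^sup>+ y. ennreal (\<bar>b y\<bar> powr p) \<partial>M) = \<infinity>")
  \<comment> \<open>An infinite moment of \<open>b\<close> makes the right side infinite; otherwise
    the pointwise majorant \<open>l\<close> below is integrable and its linear term integrates to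
    zero.\<close>
  case True
  then show ?thesis by (simp add: ennreal_mult_top)
next
  case False
  have [measurable]: "b \<in> borel_measurable M" using b by auto
  have bp: "integrable M (\<lambda>y. \<bar>b y\<bar> powr p)"
    using False by (intro integrableI_nonneg) (auto simp: top.not_eq_extremum)
  define l where "l y = \<bar>c\<bar> powr p + p * (sgn c * \<bar>c\<bar> powr (p - 1)) * b y
      + 2 powr (2 - p) * \<bar>b y\<bar> powr p" for y
  have le: "\<bar>c + b y\<bar> powr p \<le> l y" for y
    unfolding l_def using assms by (intro abs_add_powr_le)
  have l: "integrable M l"
    unfolding l_def using bp b by auto
  have "(\<integral>\<^sup>+ y. ennreal (\<bar>c + b y\<bar> powr p) \<partial>M) \<le> (\<integral>\<^sup>+ y. ennreal (l y) \<partial>M)"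
    using le by (intro nn_integral_mono ennreal_leI)
  also have "\<dots> = ennreal (expectation l)"
    using l le by (intro nn_integral_eq_integral) (auto intro: order_trans[OF powr_ge_zero])
  also have "expectation l = \<bar>c\<bar> powr p + 2 powr (2 - p) * expectation (\<lambda>y. \<bar>b y\<bar> powr p)"
    unfolding l_def using bp b by (simp add: prob_space)
  also have "ennreal \<dots> = ennreal (\<bar>c\<bar> powr p)
      + ennreal (2 powr (2 - p)) * ennreal (expectation (\<lambda>y. \<bar>b y\<bar> powr p))"
    by (simp add: ennreal_plus ennreal_mult integral_nonneg_AE)
  also have "ennreal (expectation (\<lambda>y. \<bar>b y\<bar> powr p)) = (\<integral>\<^sup>+ y. ennreal (\<bar>b y\<bar> powr p) \<partial>M)"
    using bp by (intro nn_integral_eq_integral[symmetric]) auto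
  finally show ?thesis .
qed

section \<open>Powers of extended nonnegative reals\<close>

lemma epowr_ennreal: "0 \<le> x \<Longrightarrow> epowr (ennreal x) r = ennreal (x powr r)"
  by (simp add: epowr_def)

lemma epowr_top [simp]: "epowr \<top> r = \<top>"
  by (simp add: epowr_def)

lemma epowr_eq_top: "epowr x r = \<top> \<longleftrightarrow> x = \<top>"
  by (simp add: epowr_def)

lemma epowr_mono: "0 \<le> r \<Longrightarrow> x \<le> y \<Longrightarrow> epowr x r \<le> epowr y r"
  by (cases x; cases y) (auto simp: epowr_ennreal powr_mono2 ennreal_leI top_unique)

lemma epowr_cmult:
  assumes "0 < c"
  shows "epowr (ennreal c * x) r = ennreal (c powr r) * epowr x r"
proof (cases x)
  case (real t)
  then have "ennreal c * x = ennreal (c * t)"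
    using assms by (simp add: ennreal_mult)
  then have "epowr (ennreal c * x) r = ennreal ((c * t) powr r)"
    using real assms by (simp only: epowr_ennreal mult_nonneg_nonneg less_imp_le)
  then show ?thesis
    using real assms by (simp add: epowr_ennreal powr_mult ennreal_mult)
next
  case top
  then show ?thesis
    using assms by (simp add: ennreal_mult_top)
qed

lemma borel_measurable_epowr [measurable (raw)]:
  assumes [measurable]: "g \<in> borel_measurable M"
  shows "(\<lambda>x. epowr (g x) r) \<in> borel_measurable M"
proof -
  have "{x \<in> space M. g x = \<top>} \<in> sets M"
    using measurable_sets[OF assms, of "{\<top>}"] by (simp add: vimage_def Int_def conj_commute)
  then have "Measurable.pred M (\<lambda>x. g x = \<top>)"
    by (simp add: pred_def)
  moreover have "(\<lambda>x. ennreal (enn2real (g x) powr r)) \<in> borel_measurable M"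
    by measurable
  ultimately show ?thesis
    unfolding epowr_def by (intro measurable_If) auto
qed

section \<open>The Markov chain of pasts\<close>

locale contracting_recursion = prob_space M for M :: "'w measure" +
  fixes \<epsilon> :: "nat \<Rightarrow> 'w \<Rightarrow> 'y::polish_space"
    and x0 :: "int \<Rightarrow> 'x::polish_space"
    and F :: "nat \<Rightarrow> (nat \<Rightarrow> 'x) \<Rightarrow> 'y \<Rightarrow> 'x"
    and X :: "int \<Rightarrow> 'w \<Rightarrow> 'x"
    and a :: "nat \<Rightarrow> real"
    and n :: nat
    and f :: "(nat \<Rightarrow> 'x) \<Rightarrow> real"
    and p :: real
    and A :: "nat \<Rightarrow> real"
  assumes indep: "indep_vars (\<lambda>_. borel) \<epsilon> {1..}"
    and F_measurable: "\<And>m. m \<ge> 1 \<Longrightarrow>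
      (\<lambda>(s, y). F m s y) \<in> borel_measurable ((\<Pi>\<^sub>M j\<in>UNIV. borel) \<Otimes>\<^sub>M borel)"
    and X_init: "\<And>i \<omega>. i \<le> 0 \<Longrightarrow> X i \<omega> = x0 i"
    and X_rec: "\<And>m \<omega>. m \<ge> 1 \<Longrightarrow> X (int m) \<omega> = F m (past X m \<omega>) (\<epsilon> m \<omega>)"
    and a_nonneg: "\<And>i. i \<ge> 1 \<Longrightarrow> a i \<ge> 0"
    and contraction: "\<And>m s s'. m \<ge> 1 \<Longrightarrow>
      (\<integral>\<^sup>+ \<omega>. ennreal (dist (F m s (\<epsilon> m \<omega>)) (F m s' (\<epsilon> m \<omega>))) \<partial>M)
        \<le> (\<Sum>j. ennreal (a (Suc j) * dist (s j) (s' j)))"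
    and f_lipschitz: "\<And>x x'. x \<in> {1..n} \<rightarrow>\<^sub>E UNIV \<Longrightarrow> x' \<in> {1..n} \<rightarrow>\<^sub>E UNIV \<Longrightarrow>
      \<bar>f x - f x'\<bar> \<le> (\<Sum>i = 1..n. dist (x i) (x' i))"
    and p_ge_1: "1 \<le> p" and p_le_2: "p \<le> 2"
    and A_nonneg: "\<And>k. k \<in> {1..n} \<Longrightarrow> 0 \<le> A k"
    and H_moment: "\<And>k. k \<in> {1..n} \<Longrightarrow>
      (\<integral>\<^sup>+ \<omega>. epowr (H_fun (F k) (distr M borel (\<epsilon> k)) (past X k \<omega>) (\<epsilon> k \<omega>)) p \<partial>M)
        \<le> ennreal (A k)"
begin

abbreviation seqs :: "(nat \<Rightarrow> 'x) measure" where
  "seqs \<equiv> \<Pi>\<^sub>M j\<in>UNIV. borel"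

abbreviation law :: "nat \<Rightarrow> 'y measure" where
  "law k \<equiv> distr M borel (\<epsilon> k)"

text \<open>Transition of the chain: if \<open>s\<close> lists X_{k-1}, X_{k-2}, ... and
  \<open>y\<close> is the innovation at time k, the result lists X_k, X_{k-1}, ....\<close>

definition push :: "nat \<Rightarrow> (nat \<Rightarrow> 'x) \<Rightarrow> 'y \<Rightarrow> (nat \<Rightarrow> 'x)" where
  "push k s y = case_nat (F k s y) s"

text \<open>The possible states at time k: k free entries X_k, ..., X_1, followed by the prescribed
  initial sequence. Two such states differ in finitely many places, so the distance sums below are
  finite. The state at time k is \<open>past X (Suc k)\<close>, since \<open>past X m\<close> starts
  at X_{m-1}.\<close>

definition admissible :: "nat \<Rightarrow> (nat \<Rightarrow> 'x) set" where
  "admissible k = {s. \<forall>i. s (k + i) = x0 (- int i)}"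

lemma push_0 [simp]: "push k s y 0 = F k s y"
  and push_Suc [simp]: "push k s y (Suc j) = s j"
  by (simp_all add: push_def)

lemma past_1: "past X (Suc 0) \<omega> = (\<lambda>j. x0 (- int j))"
  by (simp add: past_def X_init)

lemma past_Suc: "past X (Suc (Suc k)) \<omega> = push (Suc k) (past X (Suc k) \<omega>) (\<epsilon> (Suc k) \<omega>)"
proof
  fix j
  show "past X (Suc (Suc k)) \<omega> j = push (Suc k) (past X (Suc k) \<omega>) (\<epsilon> (Suc k) \<omega>) j"
    using X_rec[of "Suc k" \<omega>] by (cases j) (simp_all add: past_def algebra_simps)
qed

lemma past_admissible: "past X (Suc k) \<omega> \<in> admissible k"
  by (simp add: admissible_def past_def X_init)

lemma push_admissible: "s \<in> admissible k \<Longrightarrow> push m s y \<in> admissible (Suc k)"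
  by (simp add: admissible_def)

lemma admissible_eq: "s \<in> admissible k \<Longrightarrow> s' \<in> admissible k \<Longrightarrow> k \<le> j \<Longrightarrow> s j = s' j"
  by (auto simp: admissible_def dest!: spec[of _ "j - k"])

section \<open>Measurability of the chain, and independence of past and next innovation\<close>

lemma noise_measurable [measurable]: "\<epsilon> (Suc k) \<in> borel_measurable M"
  using indep by (auto simp: indep_vars_def)

lemma law_prob_space: "prob_space (law (Suc k))"
  by (rule prob_space_distr) simp

lemma F_measurable' [measurable (raw)]:
  assumes [measurable]: "g \<in> measurable N seqs" "h \<in> borel_measurable N"
  shows "(\<lambda>x. F (Suc k) (g x) (h x)) \<in> borel_measurable N"
  using measurable_compose[OF measurable_Pair[OF assms] F_measurable[of "Suc k"]] by simp

lemma push_measurable [measurable (raw)]: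
  assumes [measurable]: "g \<in> measurable N seqs" "h \<in> borel_measurable N"
  shows "(\<lambda>x. push (Suc k) (g x) (h x)) \<in> measurable N seqs"
  unfolding push_def by measurable

lemma F_section_measurable [measurable]: "(\<lambda>y. F (Suc k) s y) \<in> borel_measurable borel"
  by (intro F_measurable' measurable_const) (auto simp: space_PiM)

lemma past_measurable [measurable]: "past X (Suc k) \<in> measurable M seqs"
proof (induction k)
  case 0
  then show ?case by (simp add: past_1[abs_def] space_PiM)
next
  case (Suc k)
  note [measurable] = Suc
  have "past X (Suc (Suc k)) = (\<lambda>\<omega>. push (Suc k) (past X (Suc k) \<omega>) (\<epsilon> (Suc k) \<omega>))"
    by (simp add: past_Suc fun_eq_iff)
  then show ?case by simp
qed

text \<open>Independence is assumed for the innovations only. It reaches the past because the past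
  is a measurable function of the finite block of innovations up to time k.\<close>

lemma past_eq_noise:
  "\<exists>h\<in>measurable (\<Pi>\<^sub>M i\<in>{Suc 0..k}. borel) seqs.
    \<forall>\<omega>. past X (Suc k) \<omega> = h (\<lambda>i\<in>{Suc 0..k}. \<epsilon> i \<omega>)"
proof (induction k)
  case 0
  show ?case
    by (rule bexI[of _ "\<lambda>_ j. x0 (- int j)"]) (simp_all add: past_1 space_PiM)
next
  case (Suc k)
  then obtain h where h [measurable]: "h \<in> measurable (\<Pi>\<^sub>M i\<in>{Suc 0..k}. borel) seqs"
    and eq: "\<And>\<omega>. past X (Suc k) \<omega> = h (\<lambda>i\<in>{Suc 0..k}. \<epsilon> i \<omega>)"
    by blast
  have [measurable]: "(\<lambda>e. restrict e {Suc 0..k})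
      \<in> measurable (\<Pi>\<^sub>M i\<in>{Suc 0..Suc k}. borel) (\<Pi>\<^sub>M i\<in>{Suc 0..k}. borel :: 'y measure)"
    by (rule measurable_restrict_subset) auto
  have [measurable]: "(\<lambda>e. e (Suc k)) \<in> borel_measurable (\<Pi>\<^sub>M i\<in>{Suc 0..Suc k}. borel :: 'y measure)"
    by (rule measurable_component_singleton) auto
  show ?case
  proof (rule bexI[of _ "\<lambda>e. push (Suc k) (h (restrict e {Suc 0..k})) (e (Suc k))"], intro allI)
    fix \<omega>
    have "restrict (\<lambda>i\<in>{Suc 0..Suc k}. \<epsilon> i \<omega>) {Suc 0..k} = (\<lambda>i\<in>{Suc 0..k}. \<epsilon> i \<omega>)"
      by (auto simp: fun_eq_iff)
    then show "past X (Suc (Suc k)) \<omega> = push (Suc k) (h (restrict (\<lambda>i\<in>{Suc 0..Suc k}. \<epsilon> i \<omega>) {Suc 0..k}))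
        ((\<lambda>i\<in>{Suc 0..Suc k}. \<epsilon> i \<omega>) (Suc k))"
      by (simp add: past_Suc eq del: restrict_apply) simp
  qed measurable
qed

text \<open>The blocks {1..k} and {k+1} of innovations are disjoint, hence independent, so their
  joint law is a product. Pushing this product forward, by \<open>h\<close> on the first block and
  by evaluation at k+1 on the second, gives the claim.\<close>

lemma distr_past_noise:
  "distr M (seqs \<Otimes>\<^sub>M borel) (\<lambda>\<omega>. (past X (Suc k) \<omega>, \<epsilon> (Suc k) \<omega>))
    = distr M seqs (past X (Suc k)) \<Otimes>\<^sub>M law (Suc k)"
proof -
  obtain h where h: "h \<in> measurable (\<Pi>\<^sub>M i\<in>{Suc 0..k}. borel) seqs"
    and eq: "\<And>\<omega>. past X (Suc k) \<omega> = h (\<lambda>i\<in>{Suc 0..k}. \<epsilon> i \<omega>)"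
    using past_eq_noise by blast
  let ?P = "\<Pi>\<^sub>M i\<in>{Suc 0..k}. borel :: 'y measure" and ?Q = "\<Pi>\<^sub>M i\<in>{Suc k}. borel :: 'y measure"
  let ?U = "\<lambda>\<omega>. \<lambda>i\<in>{Suc 0..k}. \<epsilon> i \<omega>" and ?V = "\<lambda>\<omega>. \<lambda>i\<in>{Suc k}. \<epsilon> i \<omega>"
  note [measurable] = h
  have "indep_var ?P ?U ?Q ?V"
    by (rule indep_var_restrict[OF indep]) auto
  then have [measurable]: "?U \<in> measurable M ?P" "?V \<in> measurable M ?Q"
    and UV: "distr M ?P ?U \<Otimes>\<^sub>M distr M ?Q ?V = distr M (?P \<Otimes>\<^sub>M ?Q) (\<lambda>\<omega>. (?U \<omega>, ?V \<omega>))"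
    by (simp_all only: indep_var_distribution_eq)
  have proj [measurable]: "(\<lambda>e. e (Suc k)) \<in> borel_measurable ?Q"
    by (rule measurable_component_singleton) simp
  have past: "distr M seqs (past X (Suc k)) = distr (distr M ?P ?U) seqs h"
    by (subst distr_distr) (auto simp: comp_def eq[symmetric] eta_contract_eq)
  have noise: "law (Suc k) = distr (distr M ?Q ?V) borel (\<lambda>e. e (Suc k))"
    by (subst distr_distr) (auto simp: comp_def)
  have "prob_space (distr (distr M ?Q ?V) borel (\<lambda>e. e (Suc k)))"
    by (intro prob_space.prob_space_distr prob_space_distr) auto
  then have "distr (distr M ?P ?U) seqs h \<Otimes>\<^sub>M distr (distr M ?Q ?V) borel (\<lambda>e. e (Suc k))
      = distr (distr M ?P ?U \<Otimes>\<^sub>M distr M ?Q ?V) (seqs \<Otimes>\<^sub>M borel) (\<lambda>(u, v). (h u, v (Suc k)))"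
    by (intro pair_measure_distr prob_space_imp_sigma_finite) auto
  also have "\<dots> = distr M (seqs \<Otimes>\<^sub>M borel) (\<lambda>\<omega>. (past X (Suc k) \<omega>, \<epsilon> (Suc k) \<omega>))"
    unfolding UV by (subst distr_distr) (auto simp: comp_def eq)
  finally show ?thesis by (simp only: past noise)
qed

text \<open>Tonelli for the product law. This and its Fubini counterpart
  \<open>integral_past_noise\<close> play the role of conditioning on the past.\<close>

lemma nn_integral_past_noise:
  assumes [measurable]: "case_prod \<Phi> \<in> borel_measurable (seqs \<Otimes>\<^sub>M borel)"
  shows "(\<integral>\<^sup>+ \<omega>. \<Phi> (past X (Suc k) \<omega>) (\<epsilon> (Suc k) \<omega>) \<partial>M)
    = (\<integral>\<^sup>+ \<omega>. \<integral>\<^sup>+ y. \<Phi> (past X (Suc k) \<omega>) y \<partial>law (Suc k) \<partial>M)"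
proof -
  interpret law: prob_space "law (Suc k)" by (rule law_prob_space)
  have "(\<integral>\<^sup>+ \<omega>. \<Phi> (past X (Suc k) \<omega>) (\<epsilon> (Suc k) \<omega>) \<partial>M)
      = integral\<^sup>N (distr M (seqs \<Otimes>\<^sub>M borel) (\<lambda>\<omega>. (past X (Suc k) \<omega>, \<epsilon> (Suc k) \<omega>))) (case_prod \<Phi>)"
    by (subst nn_integral_distr) auto
  also have "\<dots> = (\<integral>\<^sup>+ s. \<integral>\<^sup>+ y. \<Phi> s y \<partial>law (Suc k) \<partial>distr M seqs (past X (Suc k)))"
    unfolding distr_past_noise by (subst law.nn_integral_fst[symmetric]) auto
  also have "\<dots> = (\<integral>\<^sup>+ \<omega>. \<integral>\<^sup>+ y. \<Phi> (past X (Suc k) \<omega>) y \<partial>law (Suc k) \<partial>M)"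
    by (subst nn_integral_distr) auto
  finally show ?thesis .
qed

lemma integral_past_noise:
  fixes \<Phi> :: "(nat \<Rightarrow> 'x) \<Rightarrow> 'y \<Rightarrow> real"
  assumes [measurable]: "case_prod \<Phi> \<in> borel_measurable (seqs \<Otimes>\<^sub>M borel)"
    and int: "integrable M (\<lambda>\<omega>. \<Phi> (past X (Suc k) \<omega>) (\<epsilon> (Suc k) \<omega>))"
  shows "(\<integral> \<omega>. \<Phi> (past X (Suc k) \<omega>) (\<epsilon> (Suc k) \<omega>) \<partial>M)
    = (\<integral> \<omega>. (\<integral> y. \<Phi> (past X (Suc k) \<omega>) y \<partial>law (Suc k)) \<partial>M)"
proof -
  interpret law: prob_space "law (Suc k)" by (rule law_prob_space)
  interpret past: prob_space "distr M seqs (past X (Suc k))" by (rule prob_space_distr) simp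
  interpret pair_sigma_finite "distr M seqs (past X (Suc k))" "law (Suc k)" ..
  have "(\<integral> \<omega>. \<Phi> (past X (Suc k) \<omega>) (\<epsilon> (Suc k) \<omega>) \<partial>M)
      = integral\<^sup>L (distr M (seqs \<Otimes>\<^sub>M borel) (\<lambda>\<omega>. (past X (Suc k) \<omega>, \<epsilon> (Suc k) \<omega>))) (case_prod \<Phi>)"
    by (subst integral_distr) auto
  also have "\<dots> = (\<integral> s. \<integral> y. \<Phi> s y \<partial>law (Suc k) \<partial>distr M seqs (past X (Suc k)))"
  proof -
    have "integrable (distr M (seqs \<Otimes>\<^sub>M borel) (\<lambda>\<omega>. (past X (Suc k) \<omega>, \<epsilon> (Suc k) \<omega>))) (case_prod \<Phi>)"
      using int by (subst integrable_distr_eq) auto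
    then show ?thesis
      unfolding distr_past_noise by (subst integral_fst'[symmetric]) auto
  qed
  also have "\<dots> = (\<integral> \<omega>. (\<integral> y. \<Phi> (past X (Suc k) \<omega>) y \<partial>law (Suc k)) \<partial>M)"
    by (subst integral_distr) auto
  finally show ?thesis .
qed

text \<open>Admissible states agree from position k on, so the series in the contraction hypothesis
  reduces to its first k terms and is finite.\<close>

lemma contraction_law:
  assumes "s \<in> admissible k" "s' \<in> admissible k"
  shows "(\<integral>\<^sup>+ y. ennreal (dist (F (Suc k) s y) (F (Suc k) s' y)) \<partial>law (Suc k))
    \<le> ennreal (\<Sum>j<k. a (Suc j) * dist (s j) (s' j))"
proof -
  have "(\<integral>\<^sup>+ y. ennreal (dist (F (Suc k) s y) (F (Suc k) s' y)) \<partial>law (Suc k))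
      = (\<integral>\<^sup>+ \<omega>. ennreal (dist (F (Suc k) s (\<epsilon> (Suc k) \<omega>)) (F (Suc k) s' (\<epsilon> (Suc k) \<omega>))) \<partial>M)"
    by (subst nn_integral_distr) auto
  also have "\<dots> \<le> (\<Sum>j. ennreal (a (Suc j) * dist (s j) (s' j)))"
    by (rule contraction) simp
  also have "\<dots> = (\<Sum>j<k. ennreal (a (Suc j) * dist (s j) (s' j)))"
    using admissible_eq[OF assms] by (intro suminf_finite) auto
  also have "\<dots> = ennreal (\<Sum>j<k. a (Suc j) * dist (s j) (s' j))"
    using a_nonneg by (intro sum_ennreal) auto
  finally show ?thesis .
qed

lemma H_fun_measurable [measurable (raw)]:
  assumes [measurable]: "g \<in> measurable N seqs" "h \<in> borel_measurable N"
  shows "(\<lambda>x. H_fun (F (Suc k)) (law (Suc k)) (g x) (h x)) \<in> borel_measurable N"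
proof -
  interpret law: prob_space "law (Suc k)" by (rule law_prob_space)
  show ?thesis
    unfolding H_fun_def by measurable
qed

text \<open>Integrability is extracted from the moment bound on H: it makes H finite at some reached
  past t, so F(t; y) is integrable around a point. The contraction carries this over to every
  admissible s, and the triangle inequality to every centre z.\<close>

lemma dist_integrable:
  assumes k: "k < n" and s: "s \<in> admissible k"
  shows "integrable (law (Suc k)) (\<lambda>y. dist (F (Suc k) s y) z)"
proof -
  interpret law: prob_space "law (Suc k)" by (rule law_prob_space)
  let ?H = "\<lambda>\<omega>. H_fun (F (Suc k)) (law (Suc k)) (past X (Suc k) \<omega>) (\<epsilon> (Suc k) \<omega>)"
  have "(\<integral>\<^sup>+ \<omega>. epowr (?H \<omega>) p \<partial>M) \<noteq> \<infinity>"
    using H_moment[of "Suc k"] k by (auto simp: top_unique)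
  then have "AE \<omega> in M. epowr (?H \<omega>) p \<noteq> \<infinity>"
    by (intro nn_integral_PInf_AE) auto
  \<comment> \<open>A property that holds almost surely under a probability measure holds at some
    point.\<close>
  then obtain \<omega> where H: "?H \<omega> \<noteq> \<top>"
    using eventually_happens'[OF ae_filter_bot] by (auto simp: epowr_eq_top)
  define t where "t = past X (Suc k) \<omega>"
  define z' where "z' = F (Suc k) t (\<epsilon> (Suc k) \<omega>)"
  have t: "t \<in> admissible k"
    by (simp add: t_def past_admissible)
  have "(\<integral>\<^sup>+ y. ennreal (dist (F (Suc k) s y) (F (Suc k) t y)) \<partial>law (Suc k)) < \<infinity>"
    using contraction_law[OF s t] by (simp add: order_le_less_trans)
  then have 1: "integrable (law (Suc k)) (\<lambda>y. dist (F (Suc k) s y) (F (Suc k) t y))"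
    by (intro integrableI_nonneg) auto
  have 2: "integrable (law (Suc k)) (\<lambda>y. dist z' (F (Suc k) t y))"
    using H by (intro integrableI_nonneg) (auto simp: H_fun_def t_def z'_def top.not_eq_extremum)
  show ?thesis
  proof (rule Bochner_Integration.integrable_bound)
    show "integrable (law (Suc k)) (\<lambda>y. dist (F (Suc k) s y) (F (Suc k) t y)
        + dist z' (F (Suc k) t y) + dist z' z)"
      using 1 2 by auto
    have "dist (F (Suc k) s y) z
        \<le> dist (F (Suc k) s y) (F (Suc k) t y) + dist z' (F (Suc k) t y) + dist z' z" for y
      by (smt (verit) dist_commute dist_triangle)
    then show "AE y in law (Suc k). norm (dist (F (Suc k) s y) z)
        \<le> norm (dist (F (Suc k) s y) (F (Suc k) t y) + dist z' (F (Suc k) t y) + dist z' z)"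
      by (simp add: order_trans[OF _ abs_ge_self])
  qed measurable
qed

section \<open>Backward averages and their Lipschitz constants\<close>

text \<open>
  \<open>G m\<close> takes a sequence listing $X_{n-m}, X_{n-m-1}, \ldots$ and averages over
  $\varepsilon_{n-m+1}, \ldots, \varepsilon_n$.
\<close>

primrec G :: "nat \<Rightarrow> (nat \<Rightarrow> 'x) \<Rightarrow> real" where
  "G 0 s = f (\<lambda>i\<in>{1..n}. s (n - i))"
| "G (Suc m) s = (\<integral> y. G m (push (n - m) s y) \<partial>law (n - m))"

declare G.simps [simp del]

text \<open>
  The Lipschitz constants of \<open>G m\<close> satisfy $C_{0,j} = 1$ and
  $C_{m+1,j} = C_{m,j+1} + C_{m,0}\,a_{j+1}$, which this formula solves.
\<close>

definition C :: "nat \<Rightarrow> nat \<Rightarrow> real" where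
  "C m j = 1 + (\<Sum>l<m. diag_coeff a l * a (m - l + j))"

text \<open>The recursion for a_m(m) arises here: the term l = 0 is a_0(0) a_m = a_m, and the other
  terms form the sum in \<open>diag_coeff\<close>.\<close>

lemma C_0: "C m 0 = diag_coeff a m"
proof (cases m)
  case (Suc k)
  have "{..<Suc k} = insert 0 {1..k}" by auto
  then show ?thesis by (simp add: C_def Suc)
qed (simp add: C_def)

lemma C_Suc: "C (Suc m) j = C m (Suc j) + diag_coeff a m * a (Suc j)"
proof -
  have "(\<Sum>l<m. diag_coeff a l * a (Suc m - l + j)) = (\<Sum>l<m. diag_coeff a l * a (m - l + Suc j))"
    by (intro sum.cong) (auto simp: Suc_diff_le)
  then show ?thesis by (simp add: C_def)
qed

lemma diag_coeff_ge_1: "1 \<le> diag_coeff a m"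
proof (induction m rule: less_induct)
  case (less m)
  have "0 \<le> diag_coeff a l * a (m - l)" if "l < m" for l
    using less[OF that] a_nonneg[of "m - l"] that by simp
  then have "1 \<le> C m 0"
    by (auto simp: C_def intro!: sum_nonneg)
  then show ?case
    by (simp only: C_0)
qed

text \<open>The Lipschitz condition makes \<open>f\<close> continuous for the product topology,
  which settles m = 0; integrating over a parameter preserves measurability.\<close>

lemma G_measurable: "m \<le> n \<Longrightarrow> G m \<in> borel_measurable seqs"
proof (induction m)
  case 0
  have "isCont (\<lambda>s. f (\<lambda>i\<in>{1..n}. s (n - i))) t" for t :: "nat \<Rightarrow> 'x"
  proof -
    have "continuous_on UNIV (\<lambda>s :: nat \<Rightarrow> 'x. s j)" for j
      by (rule continuous_on_product_coordinates)
    then have "isCont (\<lambda>s :: nat \<Rightarrow> 'x. s j) t" for j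
      unfolding continuous_on_def isCont_def by blast
    then have "((\<lambda>s. \<Sum>i=1..n. dist (s (n - i)) (t (n - i))) \<longlongrightarrow> (\<Sum>i=1..n. dist (t (n - i)) (t (n - i)))) (at t)"
      by (intro tendsto_intros) (auto simp: isCont_def)
    then have lim: "((\<lambda>s. \<Sum>i=1..n. dist (s (n - i)) (t (n - i))) \<longlongrightarrow> 0) (at t)"
      by simp
    have "dist (f (\<lambda>i\<in>{1..n}. s (n - i))) (f (\<lambda>i\<in>{1..n}. t (n - i)))
        \<le> (\<Sum>i=1..n. dist (s (n - i)) (t (n - i)))" for s
      using f_lipschitz[of "\<lambda>i\<in>{1..n}. s (n - i)" "\<lambda>i\<in>{1..n}. t (n - i)"] by (simp add: dist_real_def)
    then show ?thesis
      unfolding isCont_def tendsto_dist_iff[where f = "\<lambda>s. f (\<lambda>i\<in>{1..n}. s (n - i))"]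
      by (intro tendsto_sandwich[OF _ _ tendsto_const lim] always_eventually) auto
  qed
  then have "(\<lambda>s. f (\<lambda>i\<in>{1..n}. s (n - i))) \<in> borel_measurable borel"
    by (intro borel_measurable_continuous_onI continuous_at_imp_continuous_on) auto
  \<comment> \<open>On a countable product of second countable spaces the Borel and product
    sigma-algebras coincide.\<close>
  then have "(\<lambda>s. f (\<lambda>i\<in>{1..n}. s (n - i))) \<in> borel_measurable seqs"
    using measurable_cong_sets[OF sets_PiM_equal_borel refl] by blast
  then show ?case by (simp add: G.simps(1)[abs_def])
next
  case (Suc m)
  then obtain k where k: "n - m = Suc k" by (metis Suc_diff_le diff_Suc_Suc)
  interpret law: prob_space "law (Suc k)" by (rule law_prob_space)
  note [measurable] = Suc.IH[OF Suc_leD[OF Suc.prems]]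
  show ?case unfolding G.simps(2)[abs_def] k by measurable
qed

lemma G_push_measurable:
  assumes "n = Suc m + k"
    and [measurable]: "g \<in> measurable N seqs" "h \<in> borel_measurable N"
  shows "(\<lambda>x. G m (push (Suc k) (g x) (h x))) \<in> borel_measurable N"
proof -
  have [measurable]: "G m \<in> borel_measurable seqs"
    using assms by (intro G_measurable) simp
  show ?thesis by measurable
qed

text \<open>The new head takes coefficient \<open>c 0\<close> and older entries move up one index.
  With \<open>c = C m\<close> the head coefficient is a_m(m).\<close>

lemma sum_push_dist:
  "(\<Sum>j<Suc k. c j * dist (push (Suc k) s y j) (push (Suc k) s' y' j))
    = c 0 * dist (F (Suc k) s y) (F (Suc k) s' y') + (\<Sum>j<k. c (Suc j) * dist (s j) (s' j))"
  by (subst sum.lessThan_Suc_shift) simp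

text \<open>The Lipschitz bound for \<open>G m\<close> is a premise because this lemma is used
  inside the induction that proves that bound.\<close>

lemma G_push_integrable:
  assumes n: "n = Suc m + k" and s: "s \<in> admissible k"
    and lip: "\<And>s s'. s \<in> admissible (Suc k) \<Longrightarrow> s' \<in> admissible (Suc k) \<Longrightarrow>
      \<bar>G m s - G m s'\<bar> \<le> (\<Sum>j<Suc k. C m j * dist (s j) (s' j))"
  shows "integrable (law (Suc k)) (\<lambda>y. G m (push (Suc k) s y))"
proof -
  interpret law: prob_space "law (Suc k)" by (rule law_prob_space)
  have [measurable]: "(\<lambda>y. G m (push (Suc k) s y)) \<in> borel_measurable (law (Suc k))"
    using n by (intro G_push_measurable) (auto simp: space_PiM)
  \<comment> \<open>Any reference innovation serves: it supplies the centre \<open>z\<close> and the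
    value \<open>c\<close>. The two states compared share the tail \<open>s\<close>, so only the
    distance of the heads remains.\<close>
  fix y0
  define z where "z = F (Suc k) s y0"
  define c where "c = G m (push (Suc k) s y0)"
  have le: "\<bar>G m (push (Suc k) s y) - c\<bar> \<le> diag_coeff a m * dist (F (Suc k) s y) z" for y
    using lip[OF push_admissible push_admissible, OF s s, of "Suc k" y "Suc k" y0]
    by (simp add: c_def z_def sum_push_dist C_0 del: sum.lessThan_Suc)
  have "integrable (law (Suc k)) (\<lambda>y. diag_coeff a m * dist (F (Suc k) s y) z + \<bar>c\<bar>)"
    using dist_integrable[of k s z] n s by auto
  then show ?thesis
  proof (rule Bochner_Integration.integrable_bound)
    have "\<bar>G m (push (Suc k) s y)\<bar> \<le> \<bar>diag_coeff a m * dist (F (Suc k) s y) z + \<bar>c\<bar>\<bar>" for y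
      using le[of y] by linarith
    then show "AE y in law (Suc k). norm (G m (push (Suc k) s y))
        \<le> norm (diag_coeff a m * dist (F (Suc k) s y) z + \<bar>c\<bar>)"
      by simp
  qed simp
qed

text \<open>Averaging over the innovation turns the expected head distance, weighted by a_m(m), into
  the contraction sum over older entries. Adding the shifted coefficients \<open>C m (Suc j)\<close>
  gives exactly the recursion \<open>C_Suc\<close>.\<close>

lemma G_lipschitz:
  assumes "n = m + k" "s \<in> admissible k" "s' \<in> admissible k"
  shows "\<bar>G m s - G m s'\<bar> \<le> (\<Sum>j<k. C m j * dist (s j) (s' j))"
  using assms
proof (induction m arbitrary: k s s')
  case 0
  have "\<bar>G 0 s - G 0 s'\<bar> \<le> (\<Sum>i=1..n. dist (s (n - i)) (s' (n - i)))"
    using f_lipschitz[of "\<lambda>i\<in>{1..n}. s (n - i)" "\<lambda>i\<in>{1..n}. s' (n - i)"] by (simp add: G.simps(1))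
  also have "\<dots> = (\<Sum>j<k. C 0 j * dist (s j) (s' j))"
    \<comment> \<open>States list the variables backwards, so argument i of \<open>f\<close> sits at
      position n - i; here k = n.\<close>
    using 0 by (intro sum.reindex_bij_witness[of _ "\<lambda>j. n - j" "\<lambda>j. n - j"]) (auto simp: C_def)
  finally show ?case .
next
  case (Suc m)
  interpret law: prob_space "law (Suc k)" by (rule law_prob_space)
  have nm: "n - m = Suc k" "n = m + Suc k" "n = Suc m + k" using Suc.prems by auto
  note lip = Suc.IH[OF nm(2)]
  have int: "integrable (law (Suc k)) (\<lambda>y. G m (push (Suc k) t y))" if "t \<in> admissible k" for t
    using nm(3) that lip by (rule G_push_integrable)
  let ?d = "\<lambda>y. dist (F (Suc k) s y) (F (Suc k) s' y)"
  have fin: "(\<integral>\<^sup>+ y. ennreal (?d y) \<partial>law (Suc k)) \<le> ennreal (\<Sum>j<k. a (Suc j) * dist (s j) (s' j))"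
    using Suc.prems by (intro contraction_law)
  then have d: "integrable (law (Suc k)) ?d"
    by (intro integrableI_nonneg) (auto simp: order_le_less_trans)
  have nonneg: "0 \<le> (\<Sum>j<k. a (Suc j) * dist (s j) (s' j))"
    using a_nonneg by (intro sum_nonneg) auto
  have d_le: "(\<integral> y. ?d y \<partial>law (Suc k)) \<le> (\<Sum>j<k. a (Suc j) * dist (s j) (s' j))"
    using fin nonneg d by (subst (asm) nn_integral_eq_integral) auto
  have "\<bar>G (Suc m) s - G (Suc m) s'\<bar>
      = \<bar>\<integral> y. G m (push (Suc k) s y) - G m (push (Suc k) s' y) \<partial>law (Suc k)\<bar>"
    by (simp add: G.simps(2) nm(1) Bochner_Integration.integral_diff[OF int[OF Suc.prems(2)] int[OF Suc.prems(3)]])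
  also have "\<dots> \<le> (\<integral> y. \<bar>G m (push (Suc k) s y) - G m (push (Suc k) s' y)\<bar> \<partial>law (Suc k))"
    by (rule integral_abs_bound)
  also have "\<dots> \<le> (\<integral> y. diag_coeff a m * ?d y + (\<Sum>j<k. C m (Suc j) * dist (s j) (s' j)) \<partial>law (Suc k))"
  proof (rule integral_mono)
    fix y
    show "\<bar>G m (push (Suc k) s y) - G m (push (Suc k) s' y)\<bar>
        \<le> diag_coeff a m * ?d y + (\<Sum>j<k. C m (Suc j) * dist (s j) (s' j))"
      using lip[OF push_admissible push_admissible, OF Suc.prems(2,3), of "Suc k" y "Suc k" y]
      by (simp add: sum_push_dist C_0 del: sum.lessThan_Suc)
  qed (use d int Suc.prems in auto)
  also have "\<dots> = diag_coeff a m * (\<integral> y. ?d y \<partial>law (Suc k)) + (\<Sum>j<k. C m (Suc j) * dist (s j) (s' j))"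
    using d law.prob_space by simp
  also have "\<dots> \<le> diag_coeff a m * (\<Sum>j<k. a (Suc j) * dist (s j) (s' j))
      + (\<Sum>j<k. C m (Suc j) * dist (s j) (s' j))"
    using d_le diag_coeff_ge_1[of m] by (intro add_right_mono mult_left_mono) auto
  also have "\<dots> = (\<Sum>j<k. C (Suc m) j * dist (s j) (s' j))"
    by (simp add: C_Suc sum_distrib_left sum.distrib[symmetric] algebra_simps)
  finally show ?case .
qed

section \<open>Martingale increments\<close>

lemma increment_le:
  assumes n: "n = Suc m + k" and s: "s \<in> admissible k"
  shows "ennreal \<bar>G m (push (Suc k) s e) - G (Suc m) s\<bar>
    \<le> ennreal (diag_coeff a m) * H_fun (F (Suc k)) (law (Suc k)) s e"
proof -
  interpret law: prob_space "law (Suc k)" by (rule law_prob_space)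
  have nm: "n - m = Suc k" "n = m + Suc k" using n by auto
  note lip = G_lipschitz[OF nm(2)]
  have int: "integrable (law (Suc k)) (\<lambda>y. G m (push (Suc k) s y))"
    using n s lip by (rule G_push_integrable)
  \<comment> \<open>\<open>G (Suc m) s\<close> is the mean of \<open>G m\<close> over the new
    innovation. The increment is thus an average of differences between states with common tail
    \<open>s\<close>, each at most a_m(m) times the distance of their heads; averaging these
    distances gives H.\<close>
  have "G m (push (Suc k) s e) - G (Suc m) s
      = (\<integral> y. G m (push (Suc k) s e) - G m (push (Suc k) s y) \<partial>law (Suc k))"
    using int law.prob_space by (simp add: G.simps(2) nm(1))
  then have "ennreal \<bar>G m (push (Suc k) s e) - G (Suc m) s\<bar>
      \<le> (\<integral>\<^sup>+ y. ennreal \<bar>G m (push (Suc k) s e) - G m (push (Suc k) s y)\<bar> \<partial>law (Suc k))"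
    using int integral_norm_bound_ennreal[of "law (Suc k)"
        "\<lambda>y. G m (push (Suc k) s e) - G m (push (Suc k) s y)"] by simp
  also have "\<dots> \<le> (\<integral>\<^sup>+ y. ennreal (diag_coeff a m)
      * ennreal (dist (F (Suc k) s e) (F (Suc k) s y)) \<partial>law (Suc k))"
  proof (intro nn_integral_mono)
    fix y
    have "\<bar>G m (push (Suc k) s e) - G m (push (Suc k) s y)\<bar>
        \<le> diag_coeff a m * dist (F (Suc k) s e) (F (Suc k) s y)"
      using lip[OF push_admissible push_admissible, OF s s, of "Suc k" e "Suc k" y]
      by (simp add: sum_push_dist C_0 del: sum.lessThan_Suc)
    then show "ennreal \<bar>G m (push (Suc k) s e) - G m (push (Suc k) s y)\<bar>
        \<le> ennreal (diag_coeff a m) * ennreal (dist (F (Suc k) s e) (F (Suc k) s y))"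
      using diag_coeff_ge_1[of m] by (simp add: ennreal_leI flip: ennreal_mult)
  qed
  also have "\<dots> = ennreal (diag_coeff a m) * H_fun (F (Suc k)) (law (Suc k)) s e"
    unfolding H_fun_def by (rule nn_integral_cmult) simp
  finally show ?thesis .
qed


lemma increment_powr_le:
  assumes "n = Suc m + k" "s \<in> admissible k"
  shows "ennreal (\<bar>G m (push (Suc k) s e) - G (Suc m) s\<bar> powr p)
    \<le> ennreal (diag_coeff a m powr p) * epowr (H_fun (F (Suc k)) (law (Suc k)) s e) p"
proof -
  have "ennreal (\<bar>G m (push (Suc k) s e) - G (Suc m) s\<bar> powr p)
      = epowr (ennreal \<bar>G m (push (Suc k) s e) - G (Suc m) s\<bar>) p"
    by (simp only: epowr_ennreal abs_ge_zero)
  also have "\<dots> \<le> epowr (ennreal (diag_coeff a m) * H_fun (F (Suc k)) (law (Suc k)) s e) p"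
    using p_ge_1 by (intro epowr_mono increment_le assms) simp
  also have "\<dots> = ennreal (diag_coeff a m powr p) * epowr (H_fun (F (Suc k)) (law (Suc k)) s e) p"
    using diag_coeff_ge_1[of m] by (intro epowr_cmult) simp
  finally show ?thesis .
qed

lemma increment_moment_le:
  assumes "n = Suc m + k" "s \<in> admissible k"
  shows "(\<integral>\<^sup>+ y. ennreal (\<bar>G m (push (Suc k) s y) - G (Suc m) s\<bar> powr p) \<partial>law (Suc k))
    \<le> ennreal (diag_coeff a m powr p)
      * (\<integral>\<^sup>+ y. epowr (H_fun (F (Suc k)) (law (Suc k)) s y) p \<partial>law (Suc k))"
proof -
  have "(\<integral>\<^sup>+ y. ennreal (\<bar>G m (push (Suc k) s y) - G (Suc m) s\<bar> powr p) \<partial>law (Suc k))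
    \<le> (\<integral>\<^sup>+ y. ennreal (diag_coeff a m powr p)
        * epowr (H_fun (F (Suc k)) (law (Suc k)) s y) p \<partial>law (Suc k))"
    by (intro nn_integral_mono increment_powr_le assms)
  also have "\<dots> = ennreal (diag_coeff a m powr p)
      * (\<integral>\<^sup>+ y. epowr (H_fun (F (Suc k)) (law (Suc k)) s y) p \<partial>law (Suc k))"
    by (intro nn_integral_cmult borel_measurable_epowr H_fun_measurable) (auto simp: space_PiM)
  finally show ?thesis .
qed

text \<open>The von Bahr-Esseen inequality given the past \<open>s\<close>: the increment
  \<open>?b\<close> is centred by the definition of \<open>G (Suc m)\<close>. The constant
  \<open>c\<close> is arbitrary so that the bound can be iterated with
  \<open>G_init\<close>.\<close>

lemma one_step_moment_le:
  assumes n: "n = Suc m + k" and s: "s \<in> admissible k"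
  shows "(\<integral>\<^sup>+ y. ennreal (\<bar>G m (push (Suc k) s y) - c\<bar> powr p) \<partial>law (Suc k))
    \<le> ennreal (\<bar>G (Suc m) s - c\<bar> powr p) + ennreal (2 powr (2 - p) * diag_coeff a m powr p)
      * (\<integral>\<^sup>+ y. epowr (H_fun (F (Suc k)) (law (Suc k)) s y) p \<partial>law (Suc k))"
proof -
  interpret law: prob_space "law (Suc k)" by (rule law_prob_space)
  have nm: "n - m = Suc k" "n = m + Suc k" using n by auto
  have int: "integrable (law (Suc k)) (\<lambda>y. G m (push (Suc k) s y))"
    using n s G_lipschitz[OF nm(2)] by (rule G_push_integrable)
  let ?b = "\<lambda>y. G m (push (Suc k) s y) - G (Suc m) s"
  have b: "integrable (law (Suc k)) ?b" "law.expectation ?b = 0"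
    using int law.prob_space by (simp_all add: G.simps(2) nm(1))
  have "(\<integral>\<^sup>+ y. ennreal (\<bar>G m (push (Suc k) s y) - c\<bar> powr p) \<partial>law (Suc k))
      = (\<integral>\<^sup>+ y. ennreal (\<bar>(G (Suc m) s - c) + ?b y\<bar> powr p) \<partial>law (Suc k))"
    by (intro nn_integral_cong) simp
  also have "\<dots> \<le> ennreal (\<bar>G (Suc m) s - c\<bar> powr p)
      + ennreal (2 powr (2 - p)) * (\<integral>\<^sup>+ y. ennreal (\<bar>?b y\<bar> powr p) \<partial>law (Suc k))"
    by (rule law.nn_integral_abs_add_powr_le[OF p_ge_1 p_le_2 b])
  also have "\<dots> \<le> ennreal (\<bar>G (Suc m) s - c\<bar> powr p) + ennreal (2 powr (2 - p)) *
      (ennreal (diag_coeff a m powr p)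
        * (\<integral>\<^sup>+ y. epowr (H_fun (F (Suc k)) (law (Suc k)) s y) p \<partial>law (Suc k)))"
    by (intro add_left_mono mult_left_mono increment_moment_le[OF n s]) simp
  finally show ?thesis
    by (simp add: ennreal_mult mult.assoc)
qed

section \<open>Moments of the martingale\<close>

lemma H_moment_law:
  assumes "k < n"
  shows "(\<integral>\<^sup>+ \<omega>. \<integral>\<^sup>+ y. epowr (H_fun (F (Suc k)) (law (Suc k)) (past X (Suc k) \<omega>) y) p
    \<partial>law (Suc k) \<partial>M) \<le> ennreal (A (Suc k))"
proof -
  have "(\<integral>\<^sup>+ \<omega>. \<integral>\<^sup>+ y. epowr (H_fun (F (Suc k)) (law (Suc k)) (past X (Suc k) \<omega>) y) p
      \<partial>law (Suc k) \<partial>M)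
    = (\<integral>\<^sup>+ \<omega>. epowr (H_fun (F (Suc k)) (law (Suc k)) (past X (Suc k) \<omega>) (\<epsilon> (Suc k) \<omega>)) p \<partial>M)"
    by (rule nn_integral_past_noise[symmetric]) (simp add: split_beta')
  also have "\<dots> \<le> ennreal (A (Suc k))"
    using assms by (intro H_moment) simp
  finally show ?thesis .
qed

lemma nn_integral_G_past:
  assumes "n = Suc m + k"
  shows "(\<integral>\<^sup>+ \<omega>. ennreal (\<bar>G m (past X (Suc (Suc k)) \<omega>) - c\<bar> powr p) \<partial>M)
    = (\<integral>\<^sup>+ \<omega>. \<integral>\<^sup>+ y. ennreal (\<bar>G m (push (Suc k) (past X (Suc k) \<omega>) y) - c\<bar> powr p)
        \<partial>law (Suc k) \<partial>M)"
proof -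
  have [measurable]: "G m \<in> borel_measurable seqs"
    using assms by (intro G_measurable) simp
  show ?thesis
    unfolding past_Suc by (rule nn_integral_past_noise) (simp add: split_beta')
qed

text \<open>All innovations averaged out. It is shown to be the mean of f(X_1, ..., X_n) only in
  \<open>expectation_G_past\<close>, once the moment bounds have provided integrability.\<close>

definition G_init :: real where
  "G_init = G n (\<lambda>j. x0 (- int j))"

text \<open>The induction starts at k = 1, since the first increment is bounded directly, with
  factor 1; each later step adds one term with factor 2^(2-p).\<close>

lemma G_past_moment_le:
  assumes "1 \<le> k" "k \<le> n"
  shows "(\<integral>\<^sup>+ \<omega>. ennreal (\<bar>G (n - k) (past X (Suc k) \<omega>) - G_init\<bar> powr p) \<partial>M)
    \<le> ennreal (A 1 * diag_coeff a (n - 1) powr p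
        + 2 powr (2 - p) * (\<Sum>i=2..k. diag_coeff a (n - i) powr p * A i))"
  using assms
proof (induction k rule: nat_induct_at_least)
  case base
  define m where "m = n - 1"
  have nm: "n = Suc m + 0" "n - 1 = m" using base by (simp_all add: m_def)
  let ?s = "\<lambda>j. x0 (- int j)"
  have s: "?s \<in> admissible 0" by (simp add: admissible_def)
  have "Suc m = n" using nm(1) by simp
  then have init: "G_init = G (Suc m) ?s" by (simp only: G_init_def)
  \<comment> \<open>The state before time 1 is deterministic, so the outer integral has a constant
    integrand and \<open>G_init\<close> is the conditional mean itself.\<close>
  have "(\<integral>\<^sup>+ \<omega>. ennreal (\<bar>G m (past X (Suc (Suc 0)) \<omega>) - G_init\<bar> powr p) \<partial>M)
      = (\<integral>\<^sup>+ y. ennreal (\<bar>G m (push (Suc 0) ?s y) - G_init\<bar> powr p) \<partial>law (Suc 0))"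
    by (simp add: nn_integral_G_past[OF nm(1)] past_1 emeasure_space_1)
  also have "\<dots> \<le> ennreal (diag_coeff a m powr p)
      * (\<integral>\<^sup>+ y. epowr (H_fun (F (Suc 0)) (law (Suc 0)) ?s y) p \<partial>law (Suc 0))"
    using increment_moment_le[OF nm(1) s] by (simp only: init)
  also have "\<dots> \<le> ennreal (diag_coeff a m powr p) * ennreal (A 1)"
    using H_moment_law[of 0] base by (intro mult_left_mono) (auto simp: past_1 emeasure_space_1)
  also have "\<dots> = ennreal (A 1 * diag_coeff a m powr p)"
    using A_nonneg[of 1] base by (simp add: ennreal_mult mult.commute)
  finally show ?case by (simp add: nm(2)[unfolded One_nat_def] numeral_2_eq_2)
next
  case (Suc k)
  define m where "m = n - Suc k"
  have nm: "n = Suc m + k" "n - Suc k = m" "n - k = Suc m" using Suc.prems by (simp_all add: m_def)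
  let ?I = "\<lambda>\<omega>. \<integral>\<^sup>+ y. epowr (H_fun (F (Suc k)) (law (Suc k)) (past X (Suc k) \<omega>) y) p \<partial>law (Suc k)"
  let ?B = "\<lambda>k. A 1 * diag_coeff a (n - 1) powr p
        + 2 powr (2 - p) * (\<Sum>i=2..k. diag_coeff a (n - i) powr p * A i)"
  let ?D = "2 powr (2 - p) * diag_coeff a m powr p"
  have nonneg: "0 \<le> ?B k" "0 \<le> ?D" "0 \<le> A (Suc k)"
    using A_nonneg Suc.prems Suc.hyps
    by (auto intro!: add_nonneg_nonneg mult_nonneg_nonneg sum_nonneg)
  interpret law: prob_space "law (Suc k)" by (rule law_prob_space)
  have [measurable]: "G (Suc m) \<in> borel_measurable seqs"
    using nm by (intro G_measurable) simp
  \<comment> \<open>The newest innovation is integrated first, by the one-step bound at each fixed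
    past; the past is integrated afterwards.\<close>
  have "(\<integral>\<^sup>+ \<omega>. ennreal (\<bar>G m (past X (Suc (Suc k)) \<omega>) - G_init\<bar> powr p) \<partial>M)
      \<le> (\<integral>\<^sup>+ \<omega>. ennreal (\<bar>G (Suc m) (past X (Suc k) \<omega>) - G_init\<bar> powr p) + ennreal ?D * ?I \<omega> \<partial>M)"
    unfolding nn_integral_G_past[OF nm(1)]
    by (intro nn_integral_mono one_step_moment_le[OF nm(1)] past_admissible)
  also have "\<dots> = (\<integral>\<^sup>+ \<omega>. ennreal (\<bar>G (Suc m) (past X (Suc k) \<omega>) - G_init\<bar> powr p) \<partial>M)
      + ennreal ?D * (\<integral>\<^sup>+ \<omega>. ?I \<omega> \<partial>M)"
    by (simp add: nn_integral_add nn_integral_cmult)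
  also have "\<dots> \<le> ennreal (?B k) + ennreal ?D * ennreal (A (Suc k))"
    using Suc.IH Suc.prems H_moment_law[of k]
    by (intro add_mono mult_left_mono) (auto simp: nm(3))
  also have "\<dots> = ennreal (?B k + ?D * A (Suc k))"
    using nonneg by (simp only: ennreal_plus ennreal_mult mult_nonneg_nonneg)
  also have "?B k + ?D * A (Suc k) = ?B (Suc k)"
    using Suc.hyps by (simp add: nm(2) algebra_simps)
  finally show ?case by (simp add: nm(2))
qed

text \<open>Since p >= 1, t is at most 1 + t^p, so a finite p-th moment around \<open>G_init\<close>
  suffices on a probability space.\<close>

lemma G_past_integrable:
  assumes "1 \<le> k" "k \<le> n"
  shows "integrable M (\<lambda>\<omega>. G (n - k) (past X (Suc k) \<omega>))"
proof -
  have [measurable]: "G (n - k) \<in> borel_measurable seqs"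
    by (intro G_measurable) simp
  let ?d = "\<lambda>\<omega>. G (n - k) (past X (Suc k) \<omega>) - G_init"
  have "integrable M (\<lambda>\<omega>. \<bar>?d \<omega>\<bar> powr p)"
    using G_past_moment_le[OF assms]
    by (intro integrableI_nonneg) (auto simp: order_le_less_trans)
  then have "integrable M (\<lambda>\<omega>. 1 + \<bar>G_init\<bar> + \<bar>?d \<omega>\<bar> powr p)"
    by simp
  then show ?thesis
  proof (rule Bochner_Integration.integrable_bound)
    have "t \<le> 1 + t powr p" if "0 \<le> t" for t :: real
    proof (cases "t \<le> 1")
      case False
      then have "t powr 1 \<le> t powr p" using p_ge_1 by (intro powr_mono) auto
      then show ?thesis using False by simp
    qed (simp add: add_increasing2)
    from this[OF abs_ge_zero]
    have "\<bar>G (n - k) (past X (Suc k) \<omega>)\<bar> \<le> 1 + \<bar>G_init\<bar> + \<bar>?d \<omega>\<bar> powr p" for \<omega>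
      by (smt (verit))
    then show "AE \<omega> in M. norm (G (n - k) (past X (Suc k) \<omega>))
        \<le> norm (1 + \<bar>G_init\<bar> + \<bar>?d \<omega>\<bar> powr p)"
      by (simp add: order_trans[OF _ abs_ge_self])
  qed measurable
qed

text \<open>The martingale property: averaging over the newest innovation replaces
  \<open>G m\<close> by \<open>G (Suc m)\<close>. At k = n it identifies \<open>G_init\<close> with
  the mean subtracted in \<open>S_dev\<close>.\<close>

lemma expectation_G_past:
  assumes "k \<le> n"
  shows "expectation (\<lambda>\<omega>. G (n - k) (past X (Suc k) \<omega>)) = G_init"
  using assms
proof (induction k)
  case 0
  then show ?case by (simp add: past_1 G_init_def prob_space)
next
  case (Suc k)
  define m where "m = n - Suc k"
  have nm: "n = Suc m + k" "n - Suc k = m" "n - k = Suc m" "n - m = Suc k"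
    using Suc.prems by (simp_all add: m_def)
  have [measurable]: "G m \<in> borel_measurable seqs"
    using nm by (intro G_measurable) simp
  have "integrable M (\<lambda>\<omega>. G m (push (Suc k) (past X (Suc k) \<omega>) (\<epsilon> (Suc k) \<omega>)))"
    using G_past_integrable[of "Suc k"] Suc.prems by (simp add: nm(2) past_Suc)
  then have "expectation (\<lambda>\<omega>. G m (past X (Suc (Suc k)) \<omega>))
      = expectation (\<lambda>\<omega>. G (Suc m) (past X (Suc k) \<omega>))"
    unfolding past_Suc
    by (subst integral_past_noise) (auto simp: split_beta' G.simps(2) nm(4))
  then show ?case
    using Suc by (simp add: nm)
qed

section \<open>Moment and tail bounds for the centred functional\<close>

lemma f_of_X_eq_G: "f_of_X f X n \<omega> = G 0 (past X (Suc n) \<omega>)"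
proof -
  have "(\<lambda>i\<in>{1..n}. X (int i) \<omega>) = (\<lambda>i\<in>{1..n}. past X (Suc n) \<omega> (n - i))"
    by (auto simp: past_def restrict_def fun_eq_iff of_nat_diff)
  then show ?thesis by (simp add: f_of_X_def G.simps(1))
qed

lemma S_dev_eq: "S_dev M f X n \<omega> = G 0 (past X (Suc n) \<omega>) - G_init"
  using expectation_G_past[of n] by (simp add: S_dev_def f_of_X_eq_G)

lemma S_dev_measurable [measurable]: "S_dev M f X n \<in> borel_measurable M"
proof -
  have [measurable]: "G 0 \<in> borel_measurable seqs"
    by (intro G_measurable) simp
  show ?thesis by (simp add: S_dev_eq[abs_def])
qed

lemma A_bound_nonneg:
  assumes "1 \<le> n"
  shows "0 \<le> A_bound a A n p"
  unfolding A_bound_def using A_nonneg assms by (auto intro!: add_nonneg_nonneg mult_nonneg_nonneg sum_nonneg)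

lemma S_dev_moment_le:
  assumes "1 \<le> n"
  shows "(\<integral>\<^sup>+ \<omega>. ennreal (\<bar>S_dev M f X n \<omega>\<bar> powr p) \<partial>M) \<le> ennreal (A_bound a A n p)"
  using G_past_moment_le[OF assms order_refl] by (simp add: S_dev_eq A_bound_def)

lemma Lp_norm_S_dev_le:
  assumes "1 \<le> n"
  shows "Lp_norm M p (S_dev M f X n) \<le> ennreal (A_bound a A n p powr (1 / p))"
proof -
  have "Lp_norm M p (S_dev M f X n) \<le> epowr (ennreal (A_bound a A n p)) (1 / p)"
    unfolding Lp_norm_def using p_ge_1 by (intro epowr_mono S_dev_moment_le assms) simp
  then show ?thesis
    using A_bound_nonneg[OF assms] by (simp add: epowr_ennreal)
qed

text \<open>Markov's inequality applied to the p-th power of the deviation.\<close>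

lemma prob_S_dev_ge_le:
  assumes "1 \<le> n" "0 < t"
  shows "prob {\<omega> \<in> space M. t \<le> \<bar>S_dev M f X n \<omega>\<bar>} \<le> A_bound a A n p / t powr p"
proof -
  have int: "integrable M (\<lambda>\<omega>. \<bar>S_dev M f X n \<omega>\<bar> powr p)"
    using S_dev_moment_le[OF assms(1)]
    by (intro integrableI_nonneg) (auto simp: order_le_less_trans)
  have "{\<omega> \<in> space M. t \<le> \<bar>S_dev M f X n \<omega>\<bar>} \<subseteq> {\<omega> \<in> space M. t powr p \<le> \<bar>S_dev M f X n \<omega>\<bar> powr p}"
    using assms p_ge_1 by (auto intro: powr_mono2)
  then have "prob {\<omega> \<in> space M. t \<le> \<bar>S_dev M f X n \<omega>\<bar>}
      \<le> prob {\<omega> \<in> space M. t powr p \<le> \<bar>S_dev M f X n \<omega>\<bar> powr p}"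
    by (intro finite_measure_mono) measurable
  also have "\<dots> \<le> expectation (\<lambda>\<omega>. \<bar>S_dev M f X n \<omega>\<bar> powr p) / t powr p"
    using assms by (intro integral_Markov_inequality_measure[OF int, where A = "{}"]) auto
  also have "\<dots> \<le> A_bound a A n p / t powr p"
    using S_dev_moment_le[OF assms(1)] int A_bound_nonneg[OF assms(1)]
    by (intro divide_right_mono) (auto simp: nn_integral_eq_integral)
  finally show ?thesis .
qed

end

theorem proposition4p10:
  fixes M :: "'w measure"
    and \<epsilon> :: "nat \<Rightarrow> 'w \<Rightarrow> 'y::polish_space"
    and x0 :: "int \<Rightarrow> 'x::polish_space"
    and F :: "nat \<Rightarrow> (nat \<Rightarrow> 'x) \<Rightarrow> 'y \<Rightarrow> 'x"
    and X :: "int \<Rightarrow> 'w \<Rightarrow> 'x"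
    and a :: "nat \<Rightarrow> real"
    and n :: nat
    and f :: "(nat \<Rightarrow> 'x) \<Rightarrow> real"
    and p :: real
    and A :: "nat \<Rightarrow> real"
  assumes "prob_space M"
    and "prob_space.indep_vars M (\<lambda>_. borel) \<epsilon> {1..}"
    and "\<And>m. m \<ge> 1 \<Longrightarrow>
      (\<lambda>(s, y). F m s y) \<in> borel_measurable ((\<Pi>\<^sub>M j\<in>UNIV. borel) \<Otimes>\<^sub>M borel)"
    and "\<And>i \<omega>. i \<le> 0 \<Longrightarrow> X i \<omega> = x0 i"
    and "\<And>m \<omega>. m \<ge> 1 \<Longrightarrow> X (int m) \<omega> = F m (past X m \<omega>) (\<epsilon> m \<omega>)"
    and "\<And>i. i \<ge> 1 \<Longrightarrow> a i \<ge> 0"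
    and "summable (\<lambda>j. a (Suc j))"
    and "(\<Sum>j. a (Suc j)) < 1"
    and "\<And>m s s'. m \<ge> 1 \<Longrightarrow>
      (\<integral>\<^sup>+ \<omega>. ennreal (dist (F m s (\<epsilon> m \<omega>)) (F m s' (\<epsilon> m \<omega>))) \<partial>M)
        \<le> (\<Sum>j. ennreal (a (Suc j) * dist (s j) (s' j)))"
    and "n \<ge> 1"
    and "\<And>x x'. x \<in> {1..n} \<rightarrow>\<^sub>E UNIV \<Longrightarrow> x' \<in> {1..n} \<rightarrow>\<^sub>E UNIV \<Longrightarrow>
      \<bar>f x - f x'\<bar> \<le> (\<Sum>i = 1..n. dist (x i) (x' i))"
    and "1 \<le> p" and "p \<le> 2"
    and "\<And>k. k \<in> {1..n} \<Longrightarrow>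
      enn2ereal (\<integral>\<^sup>+ \<omega>. epowr (H_fun (F k) (distr M borel (\<epsilon> k)) (past X k \<omega>) (\<epsilon> k \<omega>)) p \<partial>M)
        \<le> ereal (A k)"
  shows "Lp_norm M p (S_dev M f X n) \<le> ennreal ((A_bound a A n p) powr (1 / p))
    \<and> (\<forall>x>0. measure M {\<omega> \<in> space M. \<bar>S_dev M f X n \<omega>\<bar> \<ge> real n * x}
          \<le> A_bound a A n p / (real n * x) powr p)"
proof -
  interpret prob_space M by fact
  \<comment> \<open>The moment bound is stated in \<open>ereal\<close>, so it forces
    \<open>A k\<close> to be nonnegative; in \<open>ennreal\<close> a negative \<open>A k\<close>
    would be truncated to 0.\<close>
  have A: "0 \<le> A k" if "k \<in> {1..n}" for k
    using order_trans[OF enn2ereal_nonneg assms(14)[OF that]] by simp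
  interpret contracting_recursion M \<epsilon> x0 F X a n f p A
  proof
    fix k assume k: "k \<in> {1..n}"
    show "(\<integral>\<^sup>+ \<omega>. epowr (H_fun (F k) (distr M borel (\<epsilon> k)) (past X k \<omega>) (\<epsilon> k \<omega>)) p \<partial>M)
        \<le> ennreal (A k)"
      using assms(14)[OF k] A[OF k] by (simp add: less_eq_ennreal.rep_eq enn2ereal_ennreal)
  qed (fact assms A)+
  show ?thesis
    using Lp_norm_S_dev_le prob_S_dev_ge_le \<open>n \<ge> 1\<close> by simp
qed

end
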